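(* For all integers $m,n\geq 2$, the $m$-colour Ramsey number $R_m(n)$ satisfies $$R_m(n)\leq 1+\sum_{j=0}^{m(n-2)} m^j=1+\frac{m^{mn-2m+1}-1}{m-1}.$$
   Context: For natural numbers $m,n\ge 1$, $R_m(n)$ denotes the smallest natural number such that every complete graph on $R_m(n)$ vertices whose edges are coloured with $m$ colours (each edge receives one of $m$ given colours, not all of which need be used) contains $n$ vertices belonging to a complete edge-monochromatic subgraph, i.e. $n$ vertices such that all edges between them have the same colour. *)

theory Defs
  imports Complex_Main "HOL-Library.Ramsey"
begin

text \<open>
  The complete graph on \<open>N\<close> vertices has vertex set \<open>{..<N}\<close> and edge set \<open>nsets {..<N} 2\<close>;
  \<open>partn {..<N} n 2 {..<m}\<close> says that every edge colouring with colours in \<open>{..<m}\<close>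
  (not necessarily all used) admits an \<open>n\<close>-set of vertices, all of whose edges have the same colour.
\<close>
definition ramsey_number :: "nat \<Rightarrow> nat \<Rightarrow> nat" where
  "ramsey_number m n = (LEAST N. partn {..<N} n 2 {..<m})"

text \<open>The minimum is attained (Ramsey's theorem), so \<open>LEAST\<close> is meaningful.\<close>
lemma partn_ramsey_number: "partn {..<ramsey_number m n} n 2 {..<m}"
proof -
  obtain N :: nat where "partn_lst {..<N} (replicate m n) 2"
    using ramsey_full by blast
  then have "partn {..<N} n 2 {..<m}"
    by (fastforce simp: partn_lst_def partn_def)
  then show ?thesis
    unfolding ramsey_number_def by (rule LeastI)
qed

end

theory Submission
  imports Defs
begin

text \<open>
  The bound comes from an asymmetric Ramsey statement, in which colour \<open>c\<close> is asked for a clique of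
  size \<open>a c + 2\<close>. Write \<open>S t = 1 + m + \<dots> + m ^ t\<close>; this sequence satisfies \<open>S (t + 1) = m * S t + 1\<close>.
  Given more than \<open>S (t + 1)\<close> vertices, where \<open>t + 1\<close> is the sum of all \<open>a c\<close>, remove one vertex \<open>v\<close>:
  more than \<open>m * S t\<close> vertices remain, so for some colour \<open>c\<close> more than \<open>S t\<close> of them are joined
  to \<open>v\<close> in colour \<open>c\<close>. Either \<open>a c = 0\<close>, and a single edge at \<open>v\<close> is the wanted clique, or the
  demand on \<open>c\<close> can be lowered by one inside this neighbourhood, since \<open>v\<close> can be added to
  any clique of colour \<open>c\<close> found there. The induction thus runs on the sum of the \<open>a c\<close>, and the
  theorem is the case where \<open>a c = n - 2\<close> for each of the \<open>m\<close> colours. The closed form is the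
  sum of a geometric progression.
\<close>

text \<open>
  Every neighbour of \<open>v\<close> in \<open>A\<close> carries the colour of its edge to \<open>v\<close>, so this is the pigeonhole
  principle for the partition of \<open>A - {v}\<close> into the neighbourhoods of the various colours.
\<close>
lemma large_monochromatic_neighbourhood:
  fixes A :: "'a set" and f :: "'a set \<Rightarrow> 'c"
  assumes "finite C" and "v \<in> A" and col: "f ` nsets A 2 \<subseteq> C"
    and card: "card C * s + 1 < card A"
  obtains c B where "c \<in> C" "B \<subseteq> A - {v}" "s < card B" "\<And>x. x \<in> B \<Longrightarrow> f {v, x} = c"
proof -
  define N where "N c = {x \<in> A - {v}. f {v, x} = c}" for c
  have "finite A"
    using card by (metis card.infinite not_less0)
  have "A - {v} \<subseteq> (\<Union>c\<in>C. N c)"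
    using col \<open>v \<in> A\<close> by (auto simp: N_def nsets_2_eq)
  then have "card (A - {v}) \<le> card (\<Union>c\<in>C. N c)"
    using \<open>finite A\<close> \<open>finite C\<close> by (intro card_mono) (auto simp: N_def)
  also have "\<dots> \<le> (\<Sum>c\<in>C. card (N c))"
    using \<open>finite C\<close> by (rule card_UN_le)
  finally have "card C * s < (\<Sum>c\<in>C. card (N c))"
    using card \<open>v \<in> A\<close> \<open>finite A\<close> by simp
  then obtain c where "c \<in> C" "s < card (N c)"
    using sum_bounded_above[of C "\<lambda>c. card (N c)" s] by (force simp: not_less)
  then show thesis
    by (intro that[of c "N c"]) (auto simp: N_def)
qed

text \<open>
  Asking for cliques of possibly different sizes is what makes the induction go through: a step
  lowers the demand on one colour only. The shift by two makes a demand of zero mean a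
  single edge, the last case in which a nonempty neighbourhood is enough.
\<close>
lemma asymmetric_monochromatic_clique:
  fixes A :: "'a set" and f :: "'a set \<Rightarrow> 'c" and a :: "'c \<Rightarrow> nat"
  assumes "finite C" and "f ` nsets A 2 \<subseteq> C" and "(\<Sum>j\<le>sum a C. card C ^ j) < card A"
  shows "\<exists>c\<in>C. monochromatic A (a c + 2) 2 f c"
  using assms(2,3)
  unfolding monochromatic_def
proof (induction "sum a C" arbitrary: a A)
  case 0
  then have "1 < card A"
    by (simp flip: 0(1))
  moreover have a0: "\<And>c. c \<in> C \<Longrightarrow> a c = 0"
    using 0(1) \<open>finite C\<close> by (metis sum_eq_0_iff)
  ultimately obtain x y where xy: "x \<in> A" "y \<in> A" "x \<noteq> y"
    by (metis One_nat_def card_le_Suc0_iff_eq card.infinite not_less not_less0)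
  then have "{x, y} \<in> nsets A 2"
    by simp
  moreover from this have "f {x, y} \<in> C"
    using 0 by blast
  moreover have "nsets {x, y} 2 = {{x, y}}"
    using xy by (auto simp: nsets_2_eq)
  moreover from calculation have "a (f {x, y}) + 2 = 2"
    using a0 by simp
  ultimately show ?case
    by (metis image_empty image_insert order_refl)
next
  case (Suc t)
  let ?S = "\<Sum>j\<le>t. card C ^ j"
  have "(\<Sum>j\<le>Suc t. card C ^ j) = card C * ?S + 1"
    by (subst sum.atMost_Suc_shift) (simp add: sum_distrib_left)
  then have cardA: "card C * ?S + 1 < card A"
    using Suc.prems(2) by (simp flip: Suc.hyps(2))
  then obtain v where "v \<in> A"
    by fastforce
  then obtain c B where c: "c \<in> C" and B: "B \<subseteq> A - {v}" "?S < card B"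
    and vB: "\<And>x. x \<in> B \<Longrightarrow> f {v, x} = c"
    using large_monochromatic_neighbourhood[OF \<open>finite C\<close> _ Suc.prems(1) cardA] by metis
  have extend: "insert v H \<in> nsets A (Suc k) \<and> f ` nsets (insert v H) 2 \<subseteq> {c}"
    if "H \<in> nsets B k" "f ` nsets H 2 \<subseteq> {c}" for H k
  proof
    show "insert v H \<in> nsets A (Suc k)"
      using that(1) B \<open>v \<in> A\<close> by (auto simp: nsets_def card_insert_if)
    show "f ` nsets (insert v H) 2 \<subseteq> {c}"
    proof
      fix z assume "z \<in> f ` nsets (insert v H) 2"
      then obtain x y where z: "z = f {x, y}" and xy: "x \<in> insert v H" "y \<in> insert v H" "x \<noteq> y"
        by (auto simp: nsets_2_eq)
      have "H \<subseteq> B"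
        using that(1) by (auto simp: nsets_def)
      consider "x = v" "y \<in> H" | "y = v" "x \<in> H" | "x \<in> H" "y \<in> H"
        using xy by blast
      then show "z \<in> {c}"
      proof cases
        case 1
        then show ?thesis using vB z \<open>H \<subseteq> B\<close> by auto
      next
        case 2
        then show ?thesis using vB[of x] z \<open>H \<subseteq> B\<close> by (auto simp: insert_commute)
      next
        case 3
        then have "{x, y} \<in> nsets H 2"
          using xy by simp
        then show ?thesis using that(2) z by blast
      qed
    qed
  qed
  show ?case
  proof (cases "a c")
    case 0
    obtain x where "x \<in> B"
      using B(2) by fastforce
    then have "{x} \<in> nsets B 1"
      by (simp add: nsets_def)
    moreover have "f ` nsets {x} 2 \<subseteq> {c}"
      by (auto simp: nsets_2_eq)
    ultimately have "insert v {x} \<in> nsets A (a c + 2) \<and> f ` nsets (insert v {x}) 2 \<subseteq> {c}"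
      using extend[of "{x}" 1] 0 by (simp add: numeral_2_eq_2)
    then show ?thesis
      using c by blast
  next
    case (Suc k)
    define b where "b = a(c := k)"
    have "sum a C = Suc (sum b C)"
      using \<open>finite C\<close> c Suc by (simp add: b_def sum.remove[of C c])
    then have t: "t = sum b C"
      using Suc.hyps(2) by simp
    have "B \<subseteq> A"
      using B by blast
    then have "f ` nsets B 2 \<subseteq> C"
      using Suc.prems(1) nsets_mono by blast
    then obtain d H where d: "d \<in> C" and H: "H \<in> nsets B (b d + 2)" "f ` nsets H 2 \<subseteq> {d}"
      using Suc.hyps(1)[OF t] B(2) t by blast
    show ?thesis
    proof (cases "d = c")
      case True
      then have "insert v H \<in> nsets A (a c + 2) \<and> f ` nsets (insert v H) 2 \<subseteq> {c}"
        using extend[OF H(1)] H(2) Suc by (simp add: b_def)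
      then show ?thesis
        using c by blast
    next
      case False
      then have "H \<in> nsets A (a d + 2)"
        using H(1) nsets_mono[OF \<open>B \<subseteq> A\<close>] by (auto simp: b_def)
      then show ?thesis
        using d H(2) by blast
    qed
  qed
qed

theorem theorem1p2:
  fixes m n :: nat
  assumes "m \<ge> 2" and "n \<ge> 2"
  shows "ramsey_number m n \<le> 1 + (\<Sum>j=0..m * (n - 2). m ^ j)
    \<and> real (1 + (\<Sum>j=0..m * (n - 2). m ^ j))
        = 1 + (real m ^ (m * n - 2 * m + 1) - 1) / (real m - 1)"
proof
  let ?N = "1 + (\<Sum>j=0..m * (n - 2). m ^ j)"
  have "partn {..<?N} n 2 {..<m}"
    unfolding partn_def
  proof
    fix f assume "f \<in> nsets {..<?N} 2 \<rightarrow> {..<m}"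
    then have "f ` nsets {..<?N} 2 \<subseteq> {..<m}"
      by blast
    then have "\<exists>c\<in>{..<m}. monochromatic {..<?N} (n - 2 + 2) 2 f c"
      by (intro asymmetric_monochromatic_clique) (auto simp: atLeast0AtMost)
    moreover have "n - 2 + 2 = n"
      using \<open>n \<ge> 2\<close> by simp
    ultimately show "\<exists>c\<in>{..<m}. monochromatic {..<?N} n 2 f c"
      by simp
  qed
  then show "ramsey_number m n \<le> ?N"
    unfolding ramsey_number_def by (rule Least_le)
next
  have "real (\<Sum>j=0..m * (n - 2). m ^ j) = (\<Sum>j<m * (n - 2) + 1. real m ^ j)"
    by (simp add: atLeast0AtMost lessThan_Suc_atMost)
  also have "\<dots> = (real m ^ (m * (n - 2) + 1) - 1) / (real m - 1)"
    using \<open>m \<ge> 2\<close> by (intro geometric_sum) auto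
  also have "m * (n - 2) + 1 = m * n - 2 * m + 1"
    by (simp add: diff_mult_distrib2 mult.commute)
  finally show "real (1 + (\<Sum>j=0..m * (n - 2). m ^ j))
      = 1 + (real m ^ (m * n - 2 * m + 1) - 1) / (real m - 1)"
    by simp
qed

end
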